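(* Let $(\mathcal{U},\mathcal{S})$ be a set system with $\bigcup_{s\in\mathcal{S}}s=\mathcal{U}$ in which every element lies in at most $f$ sets, and let $\epsilon>0$. Suppose every set $s$ is assigned a level $\ell(s)\ge0$ (a real number) and a dead-weight $\phi_s\ge0$. For each element $e$ define $\ell(e)=\max_{s\in\mathcal{S}:e\in s}\ell(s)$ and $w_e=(1+\epsilon)^{-\ell(e)}$; for each set define $w_s=\sum_{e\in s}w_e$ and $w^*_s=w_s+\phi_s$. Assume: (i) $w^*_s\le 1$ for all $s\in\mathcal{S}$, and $w^*_s=1$ for every $s$ with $\ell(s)>0$; (ii) $\sum_{s\in\mathcal{S}}\phi_s\le\epsilon\cdot f\cdot\sum_{e\in\mathcal{U}}w_e$. Then the collection $\mathcal{T}^*=\{s\in\mathcal{S}: w^*_s=1\}$ is a set cover of $\mathcal{U}$ whose size is at most $(1+\epsilon)f$ times the minimum size of a set cover of $(\mathcal{U},\mathcal{S})$.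
   Context: Uniform-cost set cover: all sets have equal cost, and the goal is a set cover (subcollection whose union is $\mathcal{U}$) of minimum cardinality. *)

theory Defs
  imports Complex_Main
begin

definition set_cover :: "'a set \<Rightarrow> 'a set set \<Rightarrow> 'a set set \<Rightarrow> bool" where
  "set_cover U S C \<longleftrightarrow> C \<subseteq> S \<and> \<Union>C = U"

(* Min is taken over a finite nonempty set whenever U is finite and \<Union>S = U. *)
definition min_set_cover_size :: "'a set \<Rightarrow> 'a set set \<Rightarrow> nat" where
  "min_set_cover_size U S = Min (card ` {C. set_cover U S C})"

definition elem_level :: "'a set set \<Rightarrow> ('a set \<Rightarrow> real) \<Rightarrow> 'a \<Rightarrow> real" where
  "elem_level S lev e = Max (lev ` {s \<in> S. e \<in> s})"

definition elem_weight :: "real \<Rightarrow> 'a set set \<Rightarrow> ('a set \<Rightarrow> real) \<Rightarrow> 'a \<Rightarrow> real" where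
  "elem_weight \<epsilon> S lev e = (1 + \<epsilon>) powr (- elem_level S lev e)"

definition set_weight :: "real \<Rightarrow> 'a set set \<Rightarrow> ('a set \<Rightarrow> real) \<Rightarrow> 'a set \<Rightarrow> real" where
  "set_weight \<epsilon> S lev s = (\<Sum>e\<in>s. elem_weight \<epsilon> S lev e)"

definition total_weight ::
  "real \<Rightarrow> 'a set set \<Rightarrow> ('a set \<Rightarrow> real) \<Rightarrow> ('a set \<Rightarrow> real) \<Rightarrow> 'a set \<Rightarrow> real" where
  "total_weight \<epsilon> S lev \<phi> s = set_weight \<epsilon> S lev s + \<phi> s"

definition tight_sets ::
  "real \<Rightarrow> 'a set set \<Rightarrow> ('a set \<Rightarrow> real) \<Rightarrow> ('a set \<Rightarrow> real) \<Rightarrow> 'a set set" where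
  "tight_sets \<epsilon> S lev \<phi> = {s \<in> S. total_weight \<epsilon> S lev \<phi> s = 1}"

end

theory Submission
  imports Defs
begin

text \<open>
  A set attaining the maximal level among those containing an element \<open>e\<close> is tight: either its
  level is positive, or \<open>e\<close> has level 0 and hence weight 1 already. For the size bound, the element
  weights are a fractional packing: they total at most the size of any cover, while double counting
  over the at most \<open>f\<close> sets through each element shows that the full weights of the sets total at
  most \<open>(1 + \<epsilon>) f\<close> times the total element weight.
\<close>

lemma elem_weight_nonneg: "0 \<le> elem_weight \<epsilon> S lev e"
  by (simp add: elem_weight_def)

text \<open>Overlaps are the only source of slack: an element lying in several members of
  \<open>C\<close> is counted once on the left but once per member on the right. The induction
  discards the nonnegative weight of the overlap between the new set and the earlier union.\<close>

lemma sum_le_sum_cover: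
  fixes w :: "'a \<Rightarrow> real"
  assumes "finite C" "\<And>s. s \<in> C \<Longrightarrow> finite s" "\<And>e. e \<in> \<Union>C \<Longrightarrow> 0 \<le> w e"
  shows "sum w (\<Union>C) \<le> (\<Sum>s\<in>C. sum w s)"
  using assms
proof (induction C rule: finite_induct)
  case (insert s C)
  have "sum w (\<Union>(insert s C)) + sum w (s \<inter> \<Union>C) = sum w s + sum w (\<Union>C)"
    using insert.hyps insert.prems by (simp add: sum.union_inter finite_Union)
  moreover have "0 \<le> sum w (s \<inter> \<Union>C)"
    using insert.prems by (intro sum_nonneg) auto
  ultimately show ?case
    using insert by simp
qed simp

lemma sum_sets_le_frequency:
  fixes w :: "'a \<Rightarrow> real"
  assumes "finite U" "finite S" "\<Union>S \<subseteq> U"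
    and freq: "\<And>e. e \<in> U \<Longrightarrow> card {s \<in> S. e \<in> s} \<le> f"
    and nonneg: "\<And>e. e \<in> U \<Longrightarrow> 0 \<le> w e"
  shows "(\<Sum>s\<in>S. sum w s) \<le> real f * sum w U"
proof -
  \<comment> \<open>Writing each \<open>s\<close> as a filter on \<open>U\<close> exposes the
    incidence relation, so that the two summations can be exchanged.\<close>
  have "(\<Sum>s\<in>S. sum w s) = (\<Sum>s\<in>S. sum w {e \<in> U. e \<in> s})"
    using assms(3) by (intro sum.cong refl arg_cong[where f = "sum w"]) auto
  also have "\<dots> = (\<Sum>e\<in>U. \<Sum>s | s \<in> S \<and> e \<in> s. w e)"
    using assms by (intro sum.swap_restrict) auto
  \<comment> \<open>The inner summand does not depend on \<open>s\<close>, so the inner sum is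
    \<open>w e\<close> times the number of sets through \<open>e\<close>.\<close>
  also have "\<dots> \<le> (\<Sum>e\<in>U. real f * w e)"
    using freq nonneg by (intro sum_mono) (simp add: mult_right_mono)
  finally show ?thesis
    by (simp add: sum_distrib_left)
qed

lemma min_set_cover_size_attained:
  assumes "finite S" "\<Union>S = U"
  obtains C where "set_cover U S C" "card C = min_set_cover_size U S"
proof -
  \<comment> \<open>The first fact makes the family of covers finite, the second nonempty, so that
    \<open>Min\<close> is an attained value.\<close>
  have "{C. set_cover U S C} \<subseteq> Pow S" "set_cover U S S"
    using assms by (auto simp: set_cover_def)
  then have "min_set_cover_size U S \<in> card ` {C. set_cover U S C}"
    unfolding min_set_cover_size_def using assms(1) finite_subset
    by (intro Min_in) (blast intro: finite_imageI)+
  then show thesis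
    using that by force
qed

lemma elem_level_attained:
  assumes "finite S" "e \<in> \<Union>S"
  obtains s where "s \<in> S" "e \<in> s" "elem_level S lev e = lev s"
proof -
  have "elem_level S lev e \<in> lev ` {s \<in> S. e \<in> s}"
    unfolding elem_level_def using assms by (intro Max_in) auto
  then show thesis
    using that by blast
qed

lemma set_cover_tight_sets:
  assumes "finite S" "\<And>s. s \<in> S \<Longrightarrow> finite s"
    and "\<And>s. s \<in> S \<Longrightarrow> lev s \<ge> 0"
    and "\<And>s. s \<in> S \<Longrightarrow> \<phi> s \<ge> 0"
    and "\<And>s. s \<in> S \<Longrightarrow> total_weight \<epsilon> S lev \<phi> s \<le> 1"
    and tight: "\<And>s. s \<in> S \<Longrightarrow> lev s > 0 \<Longrightarrow> total_weight \<epsilon> S lev \<phi> s = 1"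
    and "\<epsilon> > 0"
  shows "set_cover (\<Union>S) S (tight_sets \<epsilon> S lev \<phi>)"
proof -
  have "\<exists>s\<in>tight_sets \<epsilon> S lev \<phi>. e \<in> s" if e: "e \<in> \<Union>S" for e
  proof -
    obtain s where s: "s \<in> S" "e \<in> s" "elem_level S lev e = lev s"
      using elem_level_attained assms(1) e by metis
    have "total_weight \<epsilon> S lev \<phi> s = 1"
    proof (cases "lev s > 0")
      \<comment> \<open>Here \<open>lev s = 0\<close>, so the exponent in the weight of
        \<open>e\<close> vanishes. Then 1 is at most the weight of \<open>s\<close>, which is at
        most its total weight, which is at most 1.\<close>
      case False
      then have "elem_weight \<epsilon> S lev e = 1"
        using s assms(3)[of s] \<open>\<epsilon> > 0\<close> by (simp add: elem_weight_def)
      moreover have "elem_weight \<epsilon> S lev e \<le> set_weight \<epsilon> S lev s"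
        unfolding set_weight_def using s assms(2)
        by (intro member_le_sum elem_weight_nonneg) auto
      ultimately show ?thesis
        using assms(4,5)[OF s(1)] by (simp add: total_weight_def)
    qed (use tight s in simp)
    then show ?thesis
      using s by (auto simp: tight_sets_def)
  qed
  then show ?thesis
    by (auto simp: set_cover_def tight_sets_def)
qed

theorem theorem3p1:
  fixes U :: "'a set" and S :: "'a set set" and f :: nat and \<epsilon> :: real
    and lev \<phi> :: "'a set \<Rightarrow> real"
  assumes "finite U"
    and "\<Union>S = U"
    and "\<And>e. e \<in> U \<Longrightarrow> card {s \<in> S. e \<in> s} \<le> f"
    and "\<epsilon> > 0"
    and "\<And>s. s \<in> S \<Longrightarrow> lev s \<ge> 0"
    and "\<And>s. s \<in> S \<Longrightarrow> \<phi> s \<ge> 0"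
    and "\<And>s. s \<in> S \<Longrightarrow> total_weight \<epsilon> S lev \<phi> s \<le> 1"
    and "\<And>s. s \<in> S \<Longrightarrow> lev s > 0 \<Longrightarrow> total_weight \<epsilon> S lev \<phi> s = 1"
    and "(\<Sum>s\<in>S. \<phi> s) \<le> \<epsilon> * real f * (\<Sum>e\<in>U. elem_weight \<epsilon> S lev e)"
  shows "set_cover U S (tight_sets \<epsilon> S lev \<phi>) \<and>
    real (card (tight_sets \<epsilon> S lev \<phi>)) \<le> (1 + \<epsilon>) * real f * real (min_set_cover_size U S)"
proof
  let ?w = "elem_weight \<epsilon> S lev" and ?T = "tight_sets \<epsilon> S lev \<phi>"
  \<comment> \<open>Both follow from finiteness of the union: \<open>S\<close> is a family of
    subsets of the finite set \<open>U\<close>.\<close>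
  have fin: "finite S" "\<And>s. s \<in> S \<Longrightarrow> finite s"
    using assms(1,2) finite_UnionD by (blast, metis Union_upper finite_subset)
  show "set_cover U S ?T"
    using set_cover_tight_sets[of S lev \<phi> \<epsilon>] fin assms by simp
  have set_weight: "0 \<le> set_weight \<epsilon> S lev s" for s
    unfolding set_weight_def by (intro sum_nonneg elem_weight_nonneg)
  obtain C where C: "set_cover U S C" "card C = min_set_cover_size U S"
    using min_set_cover_size_attained fin(1) assms(2) by metis
  have "C \<subseteq> S" "\<Union>C = U"
    using C by (auto simp: set_cover_def)
  then have "sum ?w U \<le> (\<Sum>s\<in>C. set_weight \<epsilon> S lev s)"
    unfolding set_weight_def using sum_le_sum_cover[of C ?w] fin
    by (auto simp: elem_weight_nonneg finite_subset subset_iff)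
  \<comment> \<open>Since \<phi> is nonnegative, the bound on the total weight also bounds the
    weight without \<phi>.\<close>
  also have "\<dots> \<le> (\<Sum>s\<in>C. 1)"
  proof (rule sum_mono)
    fix s assume "s \<in> C"
    then show "set_weight \<epsilon> S lev s \<le> 1"
      using \<open>C \<subseteq> S\<close> assms(6,7)[of s] by (auto simp: total_weight_def)
  qed
  finally have packing: "sum ?w U \<le> real (min_set_cover_size U S)"
    using C by simp
  \<comment> \<open>Each tight set contributes exactly 1, which turns the cardinality into a sum
    that can be extended to all of \<open>S\<close>.\<close>
  have "real (card ?T) = (\<Sum>s\<in>?T. total_weight \<epsilon> S lev \<phi> s)"
    by (simp add: tight_sets_def)
  also have "\<dots> \<le> (\<Sum>s\<in>S. total_weight \<epsilon> S lev \<phi> s)"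
    using fin assms(6) set_weight
    by (intro sum_mono2) (auto simp: tight_sets_def total_weight_def)
  also have "\<dots> = (\<Sum>s\<in>S. sum ?w s) + sum \<phi> S"
    by (simp add: total_weight_def set_weight_def sum.distrib)
  \<comment> \<open>Double counting bounds the first summand; the hypothesis on the total dead
    weight bounds the second.\<close>
  also have "\<dots> \<le> real f * sum ?w U + \<epsilon> * real f * sum ?w U"
    using assms fin by (intro add_mono sum_sets_le_frequency) (auto simp: elem_weight_nonneg)
  also have "\<dots> = (1 + \<epsilon>) * real f * sum ?w U"
    by (simp add: algebra_simps)
  also have "\<dots> \<le> (1 + \<epsilon>) * real f * real (min_set_cover_size U S)"
    using packing assms(4) by (intro mult_left_mono) auto
  finally show "real (card ?T) \<le> (1 + \<epsilon>) * real f * real (min_set_cover_size U S)" .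
qed

end
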